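(* Let $k\geq 1$ be a fixed integer. Then $$p=p(n)=\frac{\log n+(k+1)\log\log n-\log\log\log n}{n}$$ is a sharp threshold function for the property $\kappa_3(G(n,p))\geq k$.
   Context: $\log$ denotes the natural logarithm. $G(n,p)$ is the random graph on $n$ vertices in which each edge is present independently with probability $p$; $n\to\infty$. An event holds almost surely (a.s.) if its probability tends to $1$ as $n\to\infty$. For a graph $G$ and a set $S\subseteq V(G)$, trees $T_1,\dots,T_k$ in $G$ are internally disjoint trees connecting $S$ if $S\subseteq V(T_i)$ for all $i$, and $E(T_i)\cap E(T_j)=\emptyset$ and $V(T_i)\cap V(T_j)=S$ for all $i\neq j$. $\kappa(S)$ is the largest number of internally disjoint trees connecting $S$, and the generalized $3$-connectivity is $\kappa_3(G)=\min\{\kappa(S): S\subseteq V(G),\ |S|=3\}$; $\kappa_3(G)=0$ if $G$ is disconnected. A function $p(n)$ is a sharp threshold function for a graph property $P$ if there exist positive constants $c$ and $C$ such that for every $r(n)\geq C\cdot p(n)$, $G(n,r(n))$ a.s. satisfies $P$, and for every $r'(n)\leq c\cdot p(n)$, $G(n,r'(n))$ a.s. does not satisfy $P$. *)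

theory Defs
  imports Complex_Main
begin

text \<open>Graphs on the vertex set {0..<n}: a graph is its set of edges, each edge a
2-element subset of {0..<n}.\<close>

definition all_edges :: "nat \<Rightarrow> nat set set" where
  "all_edges n = {e. \<exists>u v. u < n \<and> v < n \<and> u \<noteq> v \<and> e = {u, v}}"

text \<open>Probability that G(n,p) (edge set E \<subseteq> all_edges n, each edge independently
with probability p) satisfies P.\<close>

definition gnp_prob :: "nat \<Rightarrow> real \<Rightarrow> (nat set set \<Rightarrow> bool) \<Rightarrow> real" where
  "gnp_prob n p P =
     (\<Sum>E \<in> {E. E \<subseteq> all_edges n \<and> P E}.
        p ^ card E * (1 - p) ^ (card (all_edges n) - card E))"

definition graph_connected :: "nat set \<Rightarrow> nat set set \<Rightarrow> bool" where
  "graph_connected V E \<longleftrightarrow> (\<forall>u\<in>V. \<forall>v\<in>V. (u, v) \<in> {(x, y). {x, y} \<in> E}\<^sup>*)"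

text \<open>A tree: finite nonempty vertex set, edges are 2-subsets of it, connected,
and |E| = |V| - 1.\<close>

definition is_tree :: "nat set \<Rightarrow> nat set set \<Rightarrow> bool" where
  "is_tree V E \<longleftrightarrow> finite V \<and> V \<noteq> {} \<and> (\<forall>e\<in>E. e \<subseteq> V \<and> card e = 2)
     \<and> graph_connected V E \<and> card E = card V - 1"

text \<open>k internally disjoint trees (TV i, TE i), i < k, in the graph ({0..<n}, E)
connecting S.\<close>

definition int_disjoint_trees ::
  "nat \<Rightarrow> nat set set \<Rightarrow> nat set \<Rightarrow> nat \<Rightarrow> (nat \<Rightarrow> nat set) \<Rightarrow> (nat \<Rightarrow> nat set set) \<Rightarrow> bool" where
  "int_disjoint_trees n E S k TV TE \<longleftrightarrow>
     (\<forall>i<k. TV i \<subseteq> {..<n} \<and> TE i \<subseteq> E \<and> is_tree (TV i) (TE i) \<and> S \<subseteq> TV i) \<and>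
     (\<forall>i<k. \<forall>j<k. i \<noteq> j \<longrightarrow> TE i \<inter> TE j = {} \<and> TV i \<inter> TV j = S)"

definition kappa_S :: "nat \<Rightarrow> nat set set \<Rightarrow> nat set \<Rightarrow> nat" where
  "kappa_S n E S = Sup {k. \<exists>TV TE. int_disjoint_trees n E S k TV TE}"

definition kappa3 :: "nat \<Rightarrow> nat set set \<Rightarrow> nat" where
  "kappa3 n E = (if graph_connected {..<n} E
                 then Inf {kappa_S n E S | S. S \<subseteq> {..<n} \<and> card S = 3}
                 else 0)"

text \<open>Sharp threshold: p is a sharp threshold function for the (n-indexed) property P.\<close>

definition sharp_threshold :: "(nat \<Rightarrow> real) \<Rightarrow> (nat \<Rightarrow> nat set set \<Rightarrow> bool) \<Rightarrow> bool" where
  "sharp_threshold p P \<longleftrightarrow>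
     (\<exists>c C. c > 0 \<and> C > 0 \<and>
        (\<forall>r. (\<forall>n. 0 \<le> r n \<and> r n \<le> 1) \<longrightarrow> (\<forall>\<^sub>F n in sequentially. r n \<ge> C * p n) \<longrightarrow>
             (\<lambda>n. gnp_prob n (r n) (P n)) \<longlonglongrightarrow> 1) \<and>
        (\<forall>r. (\<forall>n. 0 \<le> r n \<and> r n \<le> 1) \<longrightarrow> (\<forall>\<^sub>F n in sequentially. r n \<le> c * p n) \<longrightarrow>
             (\<lambda>n. gnp_prob n (r n) (P n)) \<longlonglongrightarrow> 0))"

end

theory Submission
  imports Defs "HOL-Real_Asymp.Real_Asymp"
begin

text \<open>Both constants of a sharp threshold are free, so only \<open>p(n) \<sim> log n / n\<close> matters. For
  \<open>p\<close> at most \<open>log n / (4n)\<close> the graph has an isolated vertex by the second moment method, hence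
  is disconnected. For \<open>p\<close> at least \<open>20k log n / n\<close>, cut the vertex set into \<open>k\<close> blocks of size
  \<open>n div k\<close>. A union bound over all small vertex sets \<open>A\<close> and all triples \<open>S\<close> shows that \<open>A\<close> almost surely has a
  neighbour in every block outside \<open>S\<close> and \<open>A\<close>. Taking \<open>A\<close> inside a block minus \<open>S\<close> shows that this
  part is connected, and taking \<open>A\<close> to be a singleton of \<open>S\<close> attaches the vertices of \<open>S\<close> to it as
  leaves; so every block provides one of the required \<open>k\<close> trees.\<close>

section \<open>Probabilities in the random graph\<close>

definition gnp_weight :: "nat \<Rightarrow> real \<Rightarrow> nat set set \<Rightarrow> real" where
  "gnp_weight n p E = p ^ card E * (1 - p) ^ (card (all_edges n) - card E)"

lemma finite_all_edges [simp]: "finite (all_edges n)"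
proof (rule finite_subset)
  show "all_edges n \<subseteq> Pow {..<n}"
    by (auto simp: all_edges_def)
qed simp

lemma gnp_weight_nonneg: "0 \<le> p \<Longrightarrow> p \<le> 1 \<Longrightarrow> 0 \<le> gnp_weight n p E"
  by (simp add: gnp_weight_def)

text \<open>Summing over the fixed index set \<open>Pow (all_edges n)\<close> with an indicator
  makes the probability linear in that indicator, so later inequalities can be proved graph by
  graph.\<close>

lemma gnp_prob_conv_sum:
  "gnp_prob n p P = (\<Sum>E\<in>Pow (all_edges n). gnp_weight n p E * of_bool (P E))"
proof -
  have "(\<Sum>E\<in>Pow (all_edges n). gnp_weight n p E * of_bool (P E))
      = (\<Sum>E\<in>{E\<in>Pow (all_edges n). P E}. gnp_weight n p E)"
    by (rule sum.mono_neutral_cong_right) auto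
  also have "{E\<in>Pow (all_edges n). P E} = {E. E \<subseteq> all_edges n \<and> P E}"
    by auto
  finally show ?thesis
    by (simp add: gnp_prob_def gnp_weight_def)
qed

text \<open>Binomial theorem indexed by subsets. It gives total mass 1 for \<open>x = p\<close>,
  \<open>y = 1 - p\<close>, and with \<open>y = 1\<close> it evaluates the final union bound. The
  induction splits the subsets by whether they contain \<open>a\<close>.\<close>

lemma sum_Pow_power_card:
  fixes x y :: "'a :: comm_semiring_1"
  assumes "finite U"
  shows "(\<Sum>E\<in>Pow U. x ^ card E * y ^ (card U - card E)) = (x + y) ^ card U"
  using assms
proof (induction U)
  case empty
  then show ?case by simp
next
  case (insert a U)
  let ?f = "\<lambda>E. x ^ card E * y ^ (card (insert a U) - card E)"
  have inj: "inj_on (insert a) (Pow U)"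
    using insert.hyps by (auto simp: inj_on_def)
  have "sum ?f (Pow (insert a U)) = sum ?f (Pow U) + sum ?f (insert a ` Pow U)"
    unfolding Pow_insert using insert.hyps by (intro sum.union_disjoint) auto
  also have "sum ?f (Pow U) = y * (\<Sum>E\<in>Pow U. x ^ card E * y ^ (card U - card E))"
    unfolding sum_distrib_left
  proof (rule sum.cong)
    fix E assume "E \<in> Pow U"
    then have "card E \<le> card U"
      using insert.hyps by (auto intro: card_mono)
    then show "?f E = y * (x ^ card E * y ^ (card U - card E))"
      using insert.hyps by (simp add: Suc_diff_le mult_ac)
  qed simp
  also have "sum ?f (insert a ` Pow U) = x * (\<Sum>E\<in>Pow U. x ^ card E * y ^ (card U - card E))"
    unfolding sum.reindex[OF inj] sum_distrib_left
  proof (rule sum.cong)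
    fix E assume "E \<in> Pow U"
    then have "finite E" "a \<notin> E"
      using insert.hyps by (auto intro: finite_subset)
    then show "(?f \<circ> insert a) E = x * (x ^ card E * y ^ (card U - card E))"
      using insert.hyps by (simp add: mult_ac)
  qed simp
  finally show ?case
    using insert by (simp add: algebra_simps)
qed

lemma sum_gnp_weight: "(\<Sum>E\<in>Pow (all_edges n). gnp_weight n p E) = 1"
  unfolding gnp_weight_def by (subst sum_Pow_power_card) auto

lemma gnp_prob_compl: "gnp_prob n p (\<lambda>E. \<not> P E) = 1 - gnp_prob n p P"
  unfolding gnp_prob_conv_sum sum_gnp_weight[of n p, symmetric] sum_subtractf[symmetric]
  by (rule sum.cong) auto

lemma gnp_prob_nonneg: "0 \<le> p \<Longrightarrow> p \<le> 1 \<Longrightarrow> 0 \<le> gnp_prob n p P"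
  unfolding gnp_prob_conv_sum by (intro sum_nonneg mult_nonneg_nonneg gnp_weight_nonneg) auto

lemma gnp_prob_mono:
  assumes "0 \<le> p" "p \<le> 1" "\<And>E. E \<subseteq> all_edges n \<Longrightarrow> P E \<Longrightarrow> Q E"
  shows "gnp_prob n p P \<le> gnp_prob n p Q"
  unfolding gnp_prob_conv_sum
  using assms by (intro sum_mono mult_left_mono gnp_weight_nonneg) auto

lemma gnp_prob_union_bound:
  assumes "0 \<le> p" "p \<le> 1" "finite I"
  shows "gnp_prob n p (\<lambda>E. \<exists>i\<in>I. P i E) \<le> (\<Sum>i\<in>I. gnp_prob n p (P i))"
proof -
  have *: "of_bool (\<exists>i\<in>I. P i E) \<le> (\<Sum>i\<in>I. of_bool (P i E) :: real)" for E
  proof (cases "\<exists>i\<in>I. P i E")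
    case True
    then obtain i where "i \<in> I" "P i E" by blast
    then show ?thesis
      using member_le_sum[of i I "\<lambda>i. of_bool (P i E) :: real"] assms(3) by auto
  qed (auto intro: sum_nonneg)
  have "gnp_prob n p (\<lambda>E. \<exists>i\<in>I. P i E)
      \<le> (\<Sum>E\<in>Pow (all_edges n). gnp_weight n p E * (\<Sum>i\<in>I. of_bool (P i E)))"
    unfolding gnp_prob_conv_sum
    using assms * by (intro sum_mono mult_left_mono gnp_weight_nonneg)
  also have "\<dots> = (\<Sum>i\<in>I. gnp_prob n p (P i))"
    unfolding gnp_prob_conv_sum sum_distrib_left by (rule sum.swap)
  finally show ?thesis .
qed

text \<open>The graphs avoiding \<open>F\<close> are the subsets of the remaining pairs. The factor
  for \<open>F\<close> splits off, and the other weights sum to 1.\<close>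

lemma gnp_prob_avoid:
  assumes "F \<subseteq> all_edges n"
  shows "gnp_prob n p (\<lambda>E. E \<inter> F = {}) = (1 - p) ^ card F"
proof -
  let ?U = "all_edges n"
  have fin: "finite F" and card: "card (?U - F) = card ?U - card F" "card F \<le> card ?U"
    using assms by (auto intro: finite_subset card_mono simp: card_Diff_subset finite_subset)
  have "gnp_prob n p (\<lambda>E. E \<inter> F = {})
      = (\<Sum>E\<in>Pow (?U - F). p ^ card E * (1 - p) ^ (card ?U - card E))"
    unfolding gnp_prob_def by (rule sum.cong) auto
  also have "\<dots> = (\<Sum>E\<in>Pow (?U - F). (1 - p) ^ card F *
      (p ^ card E * (1 - p) ^ (card (?U - F) - card E)))"
  proof (rule sum.cong)
    fix E assume "E \<in> Pow (?U - F)"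
    then have "card E \<le> card (?U - F)"
      by (auto intro: card_mono)
    then have "card ?U - card E = card F + (card (?U - F) - card E)"
      using card by simp
    then show "p ^ card E * (1 - p) ^ (card ?U - card E)
        = (1 - p) ^ card F * (p ^ card E * (1 - p) ^ (card (?U - F) - card E))"
      by (simp add: power_add)
  qed simp
  also have "\<dots> = (1 - p) ^ card F"
    unfolding sum_distrib_left[symmetric] by (subst sum_Pow_power_card) auto
  finally show ?thesis .
qed

section \<open>Below the threshold: isolated vertices\<close>

definition star_edges :: "nat \<Rightarrow> nat \<Rightarrow> nat set set" where
  "star_edges n v = (\<lambda>u. {v, u}) ` ({..<n} - {v})"

lemma star_edges_subset: "v < n \<Longrightarrow> star_edges n v \<subseteq> all_edges n"
  unfolding star_edges_def all_edges_def by fastforce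

lemma card_star_edges: "v < n \<Longrightarrow> card (star_edges n v) = n - 1"
  unfolding star_edges_def
  by (subst card_image) (auto simp: inj_on_def doubleton_eq_iff)

text \<open>Two stars can share only the edge joining their centres. A lower bound suffices because
  the cardinality will be an exponent of \<open>1 - p\<close>.\<close>

lemma card_star_edges_Un:
  assumes "u < n" "v < n" "u \<noteq> v"
  shows "card (star_edges n u \<union> star_edges n v) \<ge> 2 * (n - 1) - 1"
proof -
  have "star_edges n u \<inter> star_edges n v \<subseteq> {{u, v}}"
    using assms by (auto simp: star_edges_def doubleton_eq_iff)
  then have "card (star_edges n u \<inter> star_edges n v) \<le> 1"
    by (metis card.empty card_insert_disjoint card_mono empty_iff finite.emptyI finite_insert One_nat_def)
  moreover have "finite (star_edges n u)" "finite (star_edges n v)"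
    by (auto simp: star_edges_def)
  ultimately show ?thesis
    using card_Un_Int[of "star_edges n u" "star_edges n v"] assms
    by (simp add: card_star_edges)
qed

text \<open>The first edge of a walk from \<open>v\<close> to any other vertex would belong to the
  star of \<open>v\<close>.\<close>

lemma isolated_not_connected:
  assumes "v < n" "2 \<le> n" "E \<inter> star_edges n v = {}" "E \<subseteq> all_edges n"
  shows "\<not> graph_connected {..<n} E"
proof
  assume con: "graph_connected {..<n} E"
  obtain u where u: "u < n" "u \<noteq> v"
    using assms(2) by (metis less_le_trans not_less_eq one_less_numeral_iff
        semiring_norm(76) zero_less_numeral zero_neq_one)
  have "(v, u) \<in> {(x, y). {x, y} \<in> E}\<^sup>*"
    using con u assms(1) by (auto simp: graph_connected_def)
  then obtain w where "{v, w} \<in> E"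
    using u by (auto elim: converse_rtranclE)
  moreover from this have "w < n" "w \<noteq> v"
    using assms(4) by (auto simp: all_edges_def doubleton_eq_iff)
  ultimately show False
    using assms(3) by (auto simp: star_edges_def)
qed

text \<open>Chebyshev's inequality for the number of isolated vertices.\<close>

lemma gnp_prob_no_isolated_le:
  assumes p: "0 \<le> p" "p < 1" and n: "2 \<le> n"
  shows "gnp_prob n p (\<lambda>E. \<forall>v<n. E \<inter> star_edges n v \<noteq> {})
    \<le> 1 / (real n * (1 - p) ^ (n - 1)) + p / (1 - p)"
proof -
  let ?U = "Pow (all_edges n)"
  define I where "I v E = (of_bool (E \<inter> star_edges n v = {}) :: real)" for v E
  define X where "X E = (\<Sum>v<n. I v E)" for E
  define q where "q = (1 - p) ^ (n - 1)"
  define \<mu> where "\<mu> = real n * q"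
  define w where "w = gnp_weight n p"
  have q: "q > 0" and \<mu>: "\<mu> > 0"
    using p n by (auto simp: q_def \<mu>_def)
  have w: "0 \<le> w E" for E
    using p by (simp add: w_def gnp_weight_nonneg)
  have single: "(\<Sum>E\<in>?U. w E * I v E) = q" if "v < n" for v
    using gnp_prob_avoid[OF star_edges_subset[OF that], of p] that
    by (simp add: gnp_prob_conv_sum w_def I_def q_def card_star_edges)
  have EX: "(\<Sum>E\<in>?U. w E * X E) = \<mu>"
    unfolding X_def sum_distrib_left by (subst sum.swap) (simp add: single \<mu>_def)
  \<comment> \<open>Distinct vertices are nearly independent: their stars overlap in one edge, which
    costs only the factor \<open>1 / (1 - p)\<close>. The \<open>of_bool\<close> term covers the
    diagonal, where the indicator is idempotent.\<close>
  have pair: "(\<Sum>E\<in>?U. w E * (I u E * I v E)) \<le> q\<^sup>2 / (1 - p) + of_bool (u = v) * q"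
    if uv: "u < n" "v < n" for u v
  proof (cases "u = v")
    case True
    then have "I u E * I v E = I u E" for E
      by (simp add: I_def)
    then have "(\<Sum>E\<in>?U. w E * (I u E * I v E)) = q"
      using single[OF uv(1)] by (simp only:)
    then show ?thesis
      using True q p by simp
  next
    case False
    let ?F = "star_edges n u \<union> star_edges n v"
    have "(\<Sum>E\<in>?U. w E * (I u E * I v E)) = gnp_prob n p (\<lambda>E. E \<inter> ?F = {})"
      unfolding gnp_prob_conv_sum by (rule sum.cong) (auto simp: w_def I_def)
    also have "\<dots> = (1 - p) ^ card ?F"
      using uv by (intro gnp_prob_avoid) (auto dest: star_edges_subset)
    also have "\<dots> \<le> (1 - p) ^ (2 * (n - 1) - 1)"
      using p card_star_edges_Un[OF uv False] by (intro power_decreasing) auto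
    also have "\<dots> = q\<^sup>2 / (1 - p)"
    proof -
      have "q\<^sup>2 = (1 - p) ^ Suc (2 * (n - 1) - 1)"
        using n by (simp add: q_def power_mult[symmetric] mult.commute)
      then show ?thesis
        using p by (simp add: field_simps)
    qed
    finally show ?thesis
      using False by simp
  qed
  have "(\<Sum>E\<in>?U. w E * (X E)\<^sup>2) = (\<Sum>u<n. \<Sum>v<n. \<Sum>E\<in>?U. w E * (I u E * I v E))"
  proof -
    have "(\<Sum>E\<in>?U. w E * (X E)\<^sup>2) = (\<Sum>E\<in>?U. \<Sum>u<n. \<Sum>v<n. w E * (I u E * I v E))"
    proof (rule sum.cong)
      fix E
      have "(X E)\<^sup>2 = (\<Sum>u<n. \<Sum>v<n. I u E * I v E)"
        unfolding X_def power2_eq_square by (rule sum_product)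
      then show "w E * (X E)\<^sup>2 = (\<Sum>u<n. \<Sum>v<n. w E * (I u E * I v E))"
        by (simp only: sum_distrib_left)
    qed simp
    also have "\<dots> = (\<Sum>u<n. \<Sum>E\<in>?U. \<Sum>v<n. w E * (I u E * I v E))"
      by (rule sum.swap)
    also have "\<dots> = (\<Sum>u<n. \<Sum>v<n. \<Sum>E\<in>?U. w E * (I u E * I v E))"
      by (intro sum.cong refl sum.swap)
    finally show ?thesis .
  qed
  also have "\<dots> \<le> (\<Sum>u<n. \<Sum>v<n. q\<^sup>2 / (1 - p) + of_bool (u = v) * q)"
    using pair by (intro sum_mono) auto
  also have "\<dots> = (\<Sum>u<n. real n * (q\<^sup>2 / (1 - p)) + q)"
    by (intro sum.cong refl) (simp add: sum.distrib of_bool_def if_distrib[of "\<lambda>x. x * q"] cong: if_cong)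
  also have "\<dots> = \<mu>\<^sup>2 / (1 - p) + \<mu>"
    by (simp add: \<mu>_def power2_eq_square algebra_simps)
  finally have EX2: "(\<Sum>E\<in>?U. w E * (X E)\<^sup>2) \<le> \<mu>\<^sup>2 / (1 - p) + \<mu>" .
  \<comment> \<open>Without isolated vertices \<open>X E = 0\<close>, so the squared deviation
    equals \<mu> squared; elsewhere it is nonnegative.\<close>
  have "gnp_prob n p (\<lambda>E. \<forall>v<n. E \<inter> star_edges n v \<noteq> {}) * \<mu>\<^sup>2 \<le> (\<Sum>E\<in>?U. w E * (X E - \<mu>)\<^sup>2)"
    unfolding gnp_prob_conv_sum sum_distrib_right
  proof (rule sum_mono)
    fix E assume "E \<in> ?U"
    show "gnp_weight n p E * of_bool (\<forall>v<n. E \<inter> star_edges n v \<noteq> {}) * \<mu>\<^sup>2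
        \<le> w E * (X E - \<mu>)\<^sup>2"
    proof (cases "\<forall>v<n. E \<inter> star_edges n v \<noteq> {}")
      case True
      then have "X E = 0"
        by (simp add: X_def I_def)
      then show ?thesis
        using True by (simp add: w_def)
    next
      case False
      then have zero: "of_bool (\<forall>v<n. E \<inter> star_edges n v \<noteq> {}) = (0 :: real)"
        by simp
      show ?thesis
        unfolding zero using w[of E] by simp
    qed
  qed
  also have "\<dots> = (\<Sum>E\<in>?U. w E * (X E)\<^sup>2) - 2 * \<mu> * (\<Sum>E\<in>?U. w E * X E) + \<mu>\<^sup>2 * (\<Sum>E\<in>?U. w E)"
    unfolding sum_distrib_left sum_subtractf[symmetric] sum.distrib[symmetric]
    by (rule sum.cong) (auto simp: power2_eq_square algebra_simps)
  also have "\<dots> = (\<Sum>E\<in>?U. w E * (X E)\<^sup>2) - \<mu>\<^sup>2"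
    unfolding EX using sum_gnp_weight[of n p] by (simp add: w_def power2_eq_square)
  also have "\<dots> \<le> \<mu>\<^sup>2 / (1 - p) + \<mu> - \<mu>\<^sup>2"
    using EX2 by simp
  \<comment> \<open>Here \<open>1 / (1 - p) - 1 = p / (1 - p)\<close>.\<close>
  also have "\<dots> = (1 / \<mu> + p / (1 - p)) * \<mu>\<^sup>2"
    using \<mu> p by (simp add: field_simps power2_eq_square)
  finally have "gnp_prob n p (\<lambda>E. \<forall>v<n. E \<inter> star_edges n v \<noteq> {}) \<le> 1 / \<mu> + p / (1 - p)"
    by (rule mult_right_le_imp_le) (use \<mu> in simp)
  then show ?thesis
    by (simp only: \<mu>_def q_def)
qed

section \<open>Above the threshold: constructing the trees\<close>

text \<open>One vertex and one edge are added, so the edge count stays right, and every walk to or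
  from \<open>u\<close> can be routed through \<open>v\<close>.\<close>

lemma is_tree_insert_leaf:
  assumes tree: "is_tree V T" and v: "v \<in> V" and u: "u \<notin> V"
  shows "is_tree (insert u V) (insert {u, v} T)"
proof -
  have fin: "finite V" and sub: "\<And>e. e \<in> T \<Longrightarrow> e \<subseteq> V \<and> card e = 2"
    and con: "graph_connected V T" and card: "card T = card V - 1"
    using tree by (auto simp: is_tree_def)
  have "T \<subseteq> Pow V" using sub by auto
  then have "finite T" using fin by (meson finite_Pow_iff finite_subset)
  have new: "{u, v} \<notin> T" using sub u by blast
  have "card V > 0" using v fin by (auto simp: card_gt_0_iff)
  then have card': "card (insert {u, v} T) = card (insert u V) - 1"
    using new u fin \<open>finite T\<close> card by simp
  let ?R = "{(x, y). {x, y} \<in> insert {u, v} T}"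
  have "{(x, y). {x, y} \<in> T} \<subseteq> ?R" by auto
  then have old: "(x, y) \<in> ?R\<^sup>*" if "x \<in> V" "y \<in> V" for x y
    using con that rtrancl_mono unfolding graph_connected_def by blast
  have uv: "(u, v) \<in> ?R" "(v, u) \<in> ?R" by (auto simp: insert_commute)
  have "(u, x) \<in> ?R\<^sup>*" "(x, u) \<in> ?R\<^sup>*" if "x \<in> V" for x
    using uv old[OF v that] old[OF that v]
    by (auto intro: converse_rtrancl_into_rtrancl rtrancl_into_rtrancl)
  then have "graph_connected (insert u V) (insert {u, v} T)"
    using old by (auto simp: graph_connected_def)
  moreover have "card {u, v} = 2" using u v by (cases "u = v") auto
  ultimately show ?thesis
    using fin sub v card' by (auto simp: is_tree_def)
qed

lemma is_tree_singleton: "is_tree {v} {}"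
  by (simp add: is_tree_def graph_connected_def)

text \<open>Grow a tree from a single vertex: while its vertex set is a proper part of
  \<open>W\<close>, the cut condition supplies an edge leaving it, which attaches a new
  leaf.\<close>

lemma spanning_tree_exists:
  assumes fin: "finite W" and ne: "W \<noteq> {}"
    and cut: "\<And>A. A \<subseteq> W \<Longrightarrow> A \<noteq> {} \<Longrightarrow> A \<noteq> W \<Longrightarrow> \<exists>a\<in>A. \<exists>b\<in>W - A. {a, b} \<in> E"
  shows "\<exists>T\<subseteq>E. is_tree W T"
proof -
  have "\<exists>V\<subseteq>W. card V = Suc j \<and> (\<exists>T\<subseteq>E. is_tree V T)" if "Suc j \<le> card W" for j
    using that
  proof (induction j)
    case 0
    obtain v where "v \<in> W" using ne by auto
    then show ?case
      using is_tree_singleton[of v] by (intro exI[of _ "{v}"]) auto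
  next
    case (Suc j)
    then obtain V T where V: "V \<subseteq> W" "card V = Suc j" and T: "T \<subseteq> E" "is_tree V T"
      by auto
    have "V \<noteq> {}" "V \<noteq> W" using V Suc.prems by auto
    then obtain a b where ab: "a \<in> V" "b \<in> W - V" "{a, b} \<in> E"
      using cut[of V] V by auto
    then have "is_tree (insert b V) (insert {b, a} T)"
      using T by (intro is_tree_insert_leaf) auto
    moreover have "card (insert b V) = Suc (Suc j)"
      using ab V fin by (subst card_insert_disjoint) (auto intro: finite_subset)
    moreover have "insert b V \<subseteq> W" "insert {b, a} T \<subseteq> E"
      using ab V T by (auto simp: insert_commute)
    ultimately show ?case by blast
  qed
  from this[of "card W - 1"] obtain V T where "V \<subseteq> W" "card V = card W" "T \<subseteq> E" "is_tree V T"
    using fin ne by (metis One_nat_def Suc_pred card_gt_0_iff order_refl)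
  then show ?thesis
    using fin card_subset_eq by blast
qed

section \<open>From explicit families of trees to lower bounds on the connectivity\<close>

text \<open>A witness bounds \<open>Sup\<close> on the naturals from below once the set is bounded
  above. Trees containing three vertices have nonempty edge sets; being disjoint, these are distinct
  subsets of the finite set \<open>E\<close>.\<close>

lemma kappa_S_ge:
  assumes fin: "finite E" and S: "card S = 3" and trees: "int_disjoint_trees n E S k TV TE"
  shows "k \<le> kappa_S n E S"
proof -
  have "j \<le> card (Pow E)" if j: "int_disjoint_trees n E S j TV TE" for j TV TE
  proof -
    have sub: "TE i \<subseteq> E" "TE i \<noteq> {}" if "i < j" for i
    proof -
      have t: "is_tree (TV i) (TE i)" "S \<subseteq> TV i" "TE i \<subseteq> E"
        using j that by (auto simp: int_disjoint_trees_def)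
      then have "3 \<le> card (TV i)"
        using S by (metis card_mono is_tree_def)
      then have "card (TE i) \<noteq> 0" using t by (auto simp: is_tree_def)
      then show "TE i \<subseteq> E" "TE i \<noteq> {}" using t by auto
    qed
    have "inj_on TE {..<j}"
    proof (rule inj_onI, rule ccontr)
      fix a b assume "a \<in> {..<j}" "b \<in> {..<j}" "TE a = TE b" "a \<noteq> b"
      then show False
        using j sub[of a] unfolding int_disjoint_trees_def by (metis Int_absorb lessThan_iff)
    qed
    then show "j \<le> card (Pow E)"
      using card_inj_on_le[of TE "{..<j}" "Pow E"] sub(1) fin by auto
  qed
  then have "bdd_above {k. \<exists>TV TE. int_disjoint_trees n E S k TV TE}"
    by (intro bdd_aboveI[of _ "card (Pow E)"]) auto
  then show ?thesis
    unfolding kappa_S_def using trees by (intro cSup_upper) auto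
qed

text \<open>Since \<open>kappa3\<close> is 0 on disconnected graphs, connectivity must be derived
  too: any two vertices lie in some 3-set \<open>S\<close>, and tree number 0 for that
  \<open>S\<close> joins them.\<close>

lemma kappa3_ge:
  assumes k: "1 \<le> k" and n: "3 \<le> n" and E: "E \<subseteq> all_edges n"
    and trees: "\<And>S. S \<subseteq> {..<n} \<Longrightarrow> card S = 3 \<Longrightarrow> \<exists>TV TE. int_disjoint_trees n E S k TV TE"
  shows "k \<le> kappa3 n E"
proof -
  have "finite E" using E finite_all_edges by (rule finite_subset)
  have ex: "\<exists>S. {u, v} \<subseteq> S \<and> S \<subseteq> {..<n} \<and> card S = 3" if "u < n" "v < n" for u v
    using that n card_2_iff[of "{u, v}"] by (intro exists_subset_between) (auto simp: card_insert_if)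
  have "graph_connected {..<n} E"
    unfolding graph_connected_def
  proof (intro ballI)
    fix u v assume "u \<in> {..<n}" "v \<in> {..<n}"
    then obtain S where S: "{u, v} \<subseteq> S" "S \<subseteq> {..<n}" "card S = 3"
      using ex[of u v] by auto
    then obtain TV TE where "int_disjoint_trees n E S k TV TE"
      using trees by blast
    then have t: "TE 0 \<subseteq> E" "S \<subseteq> TV 0" "is_tree (TV 0) (TE 0)"
      using k by (auto simp: int_disjoint_trees_def)
    then have "(u, v) \<in> {(x, y). {x, y} \<in> TE 0}\<^sup>*"
      using S unfolding is_tree_def graph_connected_def by blast
    moreover have "{(x, y). {x, y} \<in> TE 0} \<subseteq> {(x, y). {x, y} \<in> E}"
      using t by auto
    ultimately show "(u, v) \<in> {(x, y). {x, y} \<in> E}\<^sup>*"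
      using rtrancl_mono by blast
  qed
  moreover have "k \<le> Inf {kappa_S n E S | S. S \<subseteq> {..<n} \<and> card S = 3}"
  proof (rule cInf_greatest)
    show "{kappa_S n E S | S. S \<subseteq> {..<n} \<and> card S = 3} \<noteq> {}"
      using ex[of 0 0] n by auto
  next
    fix x assume "x \<in> {kappa_S n E S | S. S \<subseteq> {..<n} \<and> card S = 3}"
    then show "k \<le> x"
      using trees kappa_S_ge[OF \<open>finite E\<close>] by blast
  qed
  ultimately show ?thesis by (simp add: kappa3_def)
qed

text \<open>Each tree spans one block together with \<open>S\<close>, the vertices of \<open>S\<close> being leaves; hence each
  of its edges has an end in the block, and trees for different blocks are edge-disjoint.\<close>

lemma int_disjoint_trees_from_blocks:
  assumes sub: "\<And>i. i < k \<Longrightarrow> V i \<subseteq> {..<n}"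
    and disj: "\<And>i j. i < k \<Longrightarrow> j < k \<Longrightarrow> i \<noteq> j \<Longrightarrow> V i \<inter> V j = {}"
    and S: "S \<subseteq> {..<n}" "card S = 3"
    and big: "\<And>i. i < k \<Longrightarrow> 2 \<le> card (V i - S)"
    and cut: "\<And>i A. i < k \<Longrightarrow> A \<subseteq> {..<n} \<Longrightarrow> A \<noteq> {} \<Longrightarrow> 2 * card A \<le> card (V i - S)
      \<Longrightarrow> \<exists>a\<in>A. \<exists>b\<in>V i - S - A. {a, b} \<in> E"
  shows "\<exists>TV TE. int_disjoint_trees n E S k TV TE"
proof -
  obtain x y z where xyz: "S = {x, y, z}" "x \<noteq> y" "y \<noteq> z" "x \<noteq> z"
    using S(2) by (metis card_3_iff)
  have "\<exists>T\<subseteq>E. is_tree (V i \<union> S) T \<and> (\<forall>e\<in>T. e \<inter> (V i - S) \<noteq> {})" if i: "i < k" for i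
  proof -
    let ?W = "V i - S"
    have "card ?W \<noteq> 0"
      using big[OF i] by simp
    then have W: "?W \<subseteq> {..<n}" "finite ?W" "?W \<noteq> {}"
      using sub[OF i] by (fastforce, metis card.infinite, metis card.empty)
    \<comment> \<open>Restricting to edges that meet \<open>?W\<close> carries along the property
      later used for edge-disjointness.\<close>
    have "\<exists>T\<subseteq>{e\<in>E. e \<inter> ?W \<noteq> {}}. is_tree ?W T"
    proof (rule spanning_tree_exists[OF W(2,3)])
      fix A assume A: "A \<subseteq> ?W" "A \<noteq> {}" "A \<noteq> ?W"
      have c: "card (?W - A) = card ?W - card A" "card A \<le> card ?W"
        using A W by (auto simp: card_Diff_subset finite_subset intro: card_mono)
      show "\<exists>a\<in>A. \<exists>b\<in>?W - A. {a, b} \<in> {e\<in>E. e \<inter> ?W \<noteq> {}}"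
      \<comment> \<open>The hypothesis \<open>cut\<close> covers only sets of at most half the size
        of \<open>?W\<close>. For a larger \<open>A\<close> it is applied to the complement, and the
        edge found is read backwards.\<close>
      proof (cases "2 * card A \<le> card ?W")
        case True
        then obtain a b where "a \<in> A" "b \<in> ?W - A" "{a, b} \<in> E"
          using cut[OF i, of A] A W(1) by blast
        then show ?thesis
          using A(1) by blast
      next
        case False
        then have "2 * card (?W - A) \<le> card ?W"
          using c by linarith
        then obtain a b where "a \<in> ?W - A" "b \<in> ?W - (?W - A)" "{a, b} \<in> E"
          using cut[OF i, of "?W - A"] A W(1) by blast
        then have "b \<in> A" "a \<in> ?W - A" "{b, a} \<in> E"
          by (auto simp: insert_commute)
        then show ?thesis
          by blast
      qed
    qed
    then obtain T where T: "T \<subseteq> {e\<in>E. e \<inter> ?W \<noteq> {}}" "is_tree ?W T" by auto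
    \<comment> \<open>In \<open>cut\<close> the set need not lie inside the block, so a singleton
      from \<open>S\<close> is allowed; its size condition is exactly the bound 2 in
      \<open>big\<close>.\<close>
    have nb: "\<exists>b\<in>?W. {s, b} \<in> E" if "s \<in> S" for s
    proof -
      have "\<exists>a\<in>{s}. \<exists>b\<in>?W - {s}. {a, b} \<in> E"
        using S(1) that big[OF i] by (intro cut[OF i]) auto
      then show ?thesis by blast
    qed
    obtain a b c where abc: "a \<in> ?W" "{x, a} \<in> E" "b \<in> ?W" "{y, b} \<in> E" "c \<in> ?W" "{z, c} \<in> E"
      using nb[of x] nb[of y] nb[of z] xyz(1) by blast
    have "is_tree (insert z (insert y (insert x ?W)))
        (insert {z, c} (insert {y, b} (insert {x, a} T)))"
      using T(2) abc xyz by (intro is_tree_insert_leaf) auto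
    moreover have "insert z (insert y (insert x ?W)) = V i \<union> S"
      using xyz(1) by auto
    moreover have "insert {z, c} (insert {y, b} (insert {x, a} T)) \<subseteq> {e\<in>E. e \<inter> ?W \<noteq> {}}"
      using T(1) abc by auto
    ultimately show ?thesis
      by (intro exI[of _ "insert {z, c} (insert {y, b} (insert {x, a} T))"]) auto
  qed
  then obtain TE where TE: "\<And>i. i < k \<Longrightarrow> TE i \<subseteq> E" "\<And>i. i < k \<Longrightarrow> is_tree (V i \<union> S) (TE i)"
      "\<And>i e. i < k \<Longrightarrow> e \<in> TE i \<Longrightarrow> e \<inter> (V i - S) \<noteq> {}"
    by metis
  have "TE i \<inter> TE j = {}" if ij: "i < k" "j < k" "i \<noteq> j" for i j
  proof (rule ccontr)
    assume "TE i \<inter> TE j \<noteq> {}"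
    then obtain e where e: "e \<in> TE i" "e \<in> TE j" by auto
    have "e \<subseteq> V j \<union> S" using TE(2)[OF ij(2)] e by (auto simp: is_tree_def)
    then show False using TE(3)[OF ij(1) e(1)] disj[OF ij] by auto
  qed
  moreover have "(V i \<union> S) \<inter> (V j \<union> S) = S" if "i < k" "j < k" "i \<noteq> j" for i j
    using disj[OF that] by auto
  ultimately have "int_disjoint_trees n E S k (\<lambda>i. V i \<union> S) TE"
    using TE sub S(1) by (auto simp: int_disjoint_trees_def)
  then show ?thesis by blast
qed

section \<open>Fixed blocks and the union bound over missing cuts\<close>

definition cross_edges :: "nat set \<Rightarrow> nat set \<Rightarrow> nat set set" where
  "cross_edges A B = (\<lambda>(a, b). {a, b}) ` (A \<times> B)"

lemma card_cross_edges: "A \<inter> B = {} \<Longrightarrow> card (cross_edges A B) = card A * card B"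
  unfolding cross_edges_def
  by (subst card_image) (auto simp: inj_on_def doubleton_eq_iff card_cartesian_product)

lemma cross_edges_subset:
  "A \<subseteq> {..<n} \<Longrightarrow> B \<subseteq> {..<n} \<Longrightarrow> A \<inter> B = {} \<Longrightarrow> cross_edges A B \<subseteq> all_edges n"
  unfolding cross_edges_def all_edges_def by blast

text \<open>The blocks do not depend on the graph or on \<open>S\<close>, so one union bound serves
  all triples. For positive \<open>k\<close>, the fewer than \<open>k\<close> vertices left over by
  the division lie in none of the first \<open>k\<close> blocks.\<close>

definition block :: "nat \<Rightarrow> nat \<Rightarrow> nat \<Rightarrow> nat set" where
  "block n k i = {i * (n div k)..<Suc i * (n div k)}"

lemma card_block: "card (block n k i) = n div k"
  by (simp add: block_def)

lemma block_subset: "i < k \<Longrightarrow> block n k i \<subseteq> {..<n}"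
proof -
  assume "i < k"
  then have "Suc i * (n div k) \<le> k * (n div k)"
    by (intro mult_right_mono) auto
  also have "\<dots> \<le> n" by simp
  finally show ?thesis by (auto simp: block_def)
qed

lemma block_disjoint:
  assumes "i \<noteq> j"
  shows "block n k i \<inter> block n k j = {}"
proof -
  have *: "block n k i \<inter> block n k j = {}" if "i < j" for i j
  proof -
    have "Suc i * (n div k) \<le> j * (n div k)"
      using that by (intro mult_right_mono) auto
    then show ?thesis by (auto simp: block_def)
  qed
  show ?thesis
    using *[of i j] *[of j i] assms by (cases "i < j") auto
qed

text \<open>If the construction fails, some block, triple and nonempty small \<open>A\<close> have
  no edge from \<open>A\<close> to the rest of the block. This excludes at least
  \<open>card A * n / (4 * k)\<close> pairs, so its probability is at most the
  \<open>card A\<close>-th power of the exponential. Summing over \<open>A\<close> gives the last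
  factor; \<open>k * n ^ 3\<close> counts blocks and triples.\<close>

lemma gnp_prob_kappa3_less_le:
  assumes k: "1 \<le> k" and p: "0 \<le> p" "p \<le> 1" and n: "8 * k \<le> n"
  shows "gnp_prob n p (\<lambda>E. kappa3 n E < k)
    \<le> real k * real n ^ 3 * ((1 + exp (- p * real n / (4 * real k))) ^ n - 1)"
proof -
  define q where "q = exp (- p * real n / (4 * real k))"
  have div: "real n / real k - 1 \<le> real (n div k)"
  proof -
    have "n < k * (n div k + 1)"
      using k by (simp add: dividend_less_times_div)
    then have "real n < real k * (real (n div k) + 1)"
      by (metis of_nat_1 of_nat_add of_nat_less_iff of_nat_mult)
    then show ?thesis
      using k by (simp add: field_simps)
  qed
  have "8 \<le> n div k"
    using n k by (simp add: div_le_mono less_eq_div_iff_mult_less_eq)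
  let ?W = "\<lambda>i x y z. block n k i - {x, y, z}"
  have W: "n div k - 3 \<le> card (?W i x y z)" for i x y z
  proof -
    have "card {x, y, z} \<le> 3"
      by (simp add: card_insert_if)
    then show ?thesis
      using diff_card_le_card_Diff[of "{x, y, z}" "block n k i"] by (simp add: card_block)
  qed
  \<comment> \<open>Triples are ordered and may repeat entries; the overcounting is harmless in a
    union bound and keeps the count simple.\<close>
  define J where "J = {..<k} \<times> {..<n} \<times> {..<n} \<times> {..<n}"
  define I where "I = (SIGMA (i, x, y, z) : J.
    {A. A \<subseteq> {..<n} \<and> A \<noteq> {} \<and> 2 * card A \<le> card (?W i x y z)})"
  define F where "F = (\<lambda>((i, x, y, z), A). cross_edges A (?W i x y z - A))"
  have "finite I"
    unfolding I_def J_def by (rule finite_SigmaI) auto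
  have bad: "\<exists>t\<in>I. E \<inter> F t = {}" if E: "E \<subseteq> all_edges n" and less: "kappa3 n E < k" for E
  proof (rule ccontr)
    assume none: "\<not> (\<exists>t\<in>I. E \<inter> F t = {})"
    have "k \<le> kappa3 n E"
    proof (rule kappa3_ge[OF k _ E])
      show "3 \<le> n" using n k by simp
      fix S :: "nat set" assume S: "S \<subseteq> {..<n}" "card S = 3"
      then obtain x y z where xyz: "S = {x, y, z}" by (metis card_3_iff)
      show "\<exists>TV TE. int_disjoint_trees n E S k TV TE"
      proof (rule int_disjoint_trees_from_blocks[where V = "block n k", OF _ _ S])
        fix i assume "i < k"
        show "2 \<le> card (block n k i - S)"
          using W[of i x y z] \<open>8 \<le> n div k\<close> unfolding xyz by linarith
      next
        fix i A assume A: "i < k" "A \<subseteq> {..<n}" "A \<noteq> {}" "2 * card A \<le> card (block n k i - S)"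
        then have "((i, x, y, z), A) \<in> I"
          using S xyz by (auto simp: I_def J_def)
        then have "E \<inter> F ((i, x, y, z), A) \<noteq> {}"
          using none by blast
        then show "\<exists>a\<in>A. \<exists>b\<in>block n k i - S - A. {a, b} \<in> E"
          by (auto simp: F_def cross_edges_def xyz)
      qed (auto simp: block_subset block_disjoint)
    qed
    then show False using less by simp
  qed
  have single: "gnp_prob n p (\<lambda>E. E \<inter> F t = {}) \<le> q ^ card (snd t)" if "t \<in> I" for t
  proof -
    obtain i x y z A where t: "t = ((i, x, y, z), A)" by (cases t) auto
    let ?B = "?W i x y z - A"
    have A: "i < k" "A \<subseteq> {..<n}" "A \<noteq> {}" "2 * card A \<le> card (?W i x y z)"
      using that by (auto simp: t I_def J_def)
    have "F t \<subseteq> all_edges n"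
      unfolding F_def t prod.case using A(2) block_subset[OF A(1)] by (intro cross_edges_subset) auto
    then have "gnp_prob n p (\<lambda>E. E \<inter> F t = {}) = (1 - p) ^ card (F t)"
      by (rule gnp_prob_avoid)
    also have "card (F t) = card ?B * card A"
      unfolding F_def t prod.case by (subst card_cross_edges) auto
    also have "(1 - p) ^ (card ?B * card A) = ((1 - p) ^ card ?B) ^ card A"
      by (rule power_mult)
    also have "\<dots> \<le> q ^ card A"
    proof (rule power_mono)
      have "card (?W i x y z) - card A \<le> card ?B"
        using A by (intro diff_card_le_card_Diff) (auto intro: finite_subset)
      then have "n div k - 3 \<le> 2 * card ?B"
        using W[of i x y z] A(4) by linarith
      then have "real (n div k) - 3 \<le> 2 * real (card ?B)"
        using \<open>8 \<le> n div k\<close> by linarith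
      moreover have "real n / real k \<ge> 8"
        using n k by (simp add: field_simps)
      \<comment> \<open>With \<open>x = n / k\<close>, one unit is lost to rounding and three to
        \<open>S\<close>, and \<open>A\<close> takes at most half of what remains. The assumption
        \<open>8 * k <= n\<close> is what makes \<open>(x - 4) / 2\<close> at least
        \<open>x / 4\<close>.\<close>
      moreover have "x / 4 \<le> b" if "d - 3 \<le> 2 * b" "8 \<le> x" "x - 1 \<le> d" for x b d :: real
        using that by linarith
      ultimately have B: "real n / real k / 4 \<le> real (card ?B)"
        using div by blast
      have "(1 - p) ^ card ?B \<le> exp (- p) ^ card ?B"
        using p exp_ge_add_one_self[of "- p"] by (intro power_mono) auto
      also have "\<dots> = exp (- p * real (card ?B))"
        by (simp add: exp_of_nat_mult[symmetric] mult.commute)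
      also have "\<dots> \<le> q"
        using mult_left_mono[OF B p(1)] by (simp add: q_def mult.commute)
      finally show "(1 - p) ^ card ?B \<le> q" .
    qed (use p in auto)
    finally show ?thesis by (simp add: t)
  qed
  have q0: "0 \<le> q" by (simp add: q_def)
  have "gnp_prob n p (\<lambda>E. kappa3 n E < k) \<le> gnp_prob n p (\<lambda>E. \<exists>t\<in>I. E \<inter> F t = {})"
    using bad p by (intro gnp_prob_mono) auto
  also have "\<dots> \<le> (\<Sum>t\<in>I. gnp_prob n p (\<lambda>E. E \<inter> F t = {}))"
    by (rule gnp_prob_union_bound[OF p \<open>finite I\<close>])
  also have "\<dots> \<le> (\<Sum>t\<in>I. q ^ card (snd t))"
    using single by (rule sum_mono)
  \<comment> \<open>Dropping the size restriction on \<open>A\<close> turns the dependent index set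
    into a product, whose sum has a closed form.\<close>
  also have "\<dots> \<le> (\<Sum>t\<in>J \<times> (Pow {..<n} - {{}}). q ^ card (snd t))"
    using q0 by (intro sum_mono2) (auto simp: I_def J_def)
  also have "\<dots> = (\<Sum>s\<in>J. \<Sum>A\<in>Pow {..<n} - {{}}. q ^ card A)"
    by (subst sum.cartesian_product) (simp add: case_prod_beta)
  also have "\<dots> = real k * real n ^ 3 * (\<Sum>A\<in>Pow {..<n} - {{}}. q ^ card A)"
    by (simp add: J_def card_cartesian_product power3_eq_cube)
  also have "(\<Sum>A\<in>Pow {..<n} - {{}}. q ^ card A) = (1 + q) ^ n - 1"
    using sum_Pow_power_card[of "{..<n}" q 1] by (simp add: sum_diff1 add.commute)
  finally show ?thesis by (simp add: q_def)
qed

section \<open>The threshold\<close>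

text \<open>The logarithm satisfies \<open>ln (1 - x) >= - x - 2 * x^2\<close>, and the quadratic
  term is at most \<open>x\<close> on this range. This bounds powers of \<open>1 - r n\<close> from
  below.\<close>

lemma exp_minus_twice_le:
  fixes x :: real
  assumes "0 \<le> x" "x \<le> 1 / 2"
  shows "exp (- 2 * x) \<le> 1 - x"
proof -
  have "2 * x\<^sup>2 \<le> x"
    using mult_left_mono[OF assms(2,1)] by (simp add: power2_eq_square)
  then have "- 2 * x \<le> ln (1 - x)"
    using ln_one_minus_pos_lower_bound[OF assms] by linarith
  then show ?thesis
    using assms by (simp add: ln_ge_iff)
qed

theorem theorem3:
  fixes k :: nat
  assumes "k \<ge> 1"
  shows "sharp_threshold
           (\<lambda>n. (ln (real n) + (real k + 1) * ln (ln (real n)) - ln (ln (ln (real n)))) / real n)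
           (\<lambda>n E. kappa3 n E \<ge> k)"
proof -
  define p where
    "p n = (ln (real n) + (real k + 1) * ln (ln (real n)) - ln (ln (ln (real n)))) / real n" for n
  have k: "real k > 0" using assms by simp
  \<comment> \<open>The iterated logarithms are of lower order, so \<open>p n\<close> is eventually
    between one and two times \<open>ln n / n\<close>.\<close>
  have lower: "\<forall>\<^sub>F n in sequentially. ln (real n) / real n \<le> p n"
    unfolding p_def using k by real_asymp
  have upper: "\<forall>\<^sub>F n in sequentially. p n \<le> 2 * ln (real n) / real n"
    unfolding p_def using k by real_asymp
  have above: "(\<lambda>n. gnp_prob n (r n) (\<lambda>E. kappa3 n E \<ge> k)) \<longlonglongrightarrow> 1"
    if r: "\<And>n. 0 \<le> r n \<and> r n \<le> 1" and ge: "\<forall>\<^sub>F n in sequentially. r n \<ge> 20 * real k * p n" for r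
  proof -
    \<comment> \<open>The constant \<open>20 * k\<close> makes the exponent
      \<open>r n * n / (4 * k)\<close> at least \<open>5 * ln n\<close>. Hence \<open>n * ?q\<close>
      is at most \<open>n powr - 4\<close>, which beats the factor \<open>n ^ 3\<close>:
      \<open>b n\<close> is of order \<open>k / n\<close>.\<close>
    define b where "b n = real k * real n ^ 3 * (exp (real n powr - 4) - 1)" for n
    have le_b: "\<forall>\<^sub>F n in sequentially. gnp_prob n (r n) (\<lambda>E. kappa3 n E < k) \<le> b n"
      using ge lower eventually_ge_at_top[of "8 * k"] eventually_gt_at_top[of 0]
    proof eventually_elim
      case (elim n)
      let ?q = "exp (- r n * real n / (4 * real k))"
      have "20 * real k * (ln (real n) / real n) \<le> r n"
        using elim(1) mult_left_mono[OF elim(2), of "20 * real k"] by simp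
      then have "5 * ln (real n) \<le> r n * real n / (4 * real k)"
        using elim k by (simp add: field_simps)
      then have "?q \<le> exp (- 5 * ln (real n))"
        by simp
      also have "\<dots> = real n powr - 5"
        using elim by (simp add: powr_def)
      finally have "real n * ?q \<le> real n * real n powr - 5"
        by (rule mult_left_mono) simp
      also have "\<dots> = real n powr - 4"
        using elim by (subst powr_mult_base) auto
      finally have nq: "real n * ?q \<le> real n powr - 4" .
      have "(1 + ?q) ^ n \<le> exp ?q ^ n"
        by (intro power_mono) (auto simp: add_nonneg_nonneg)
      also have "\<dots> = exp (real n * ?q)"
        by (simp add: exp_of_nat_mult)
      also have "\<dots> \<le> exp (real n powr - 4)"
        using nq by simp
      finally have "real k * real n ^ 3 * ((1 + ?q) ^ n - 1) \<le> b n"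
        unfolding b_def by (intro mult_left_mono) auto
      then show ?case
        using gnp_prob_kappa3_less_le[OF assms, of "r n" n] r[of n] elim(3) by linarith
    qed
    have "b \<longlonglongrightarrow> 0"
      unfolding b_def by real_asymp
    then have "(\<lambda>n. gnp_prob n (r n) (\<lambda>E. kappa3 n E < k)) \<longlonglongrightarrow> 0"
      using r by (intro tendsto_sandwich[OF _ le_b tendsto_const] always_eventually allI gnp_prob_nonneg) auto
    then have "(\<lambda>n. 1 - gnp_prob n (r n) (\<lambda>E. kappa3 n E < k)) \<longlonglongrightarrow> 1 - 0"
      by (intro tendsto_intros)
    then show ?thesis
      by (simp add: gnp_prob_compl[symmetric] not_less)
  qed
  have below: "(\<lambda>n. gnp_prob n (r n) (\<lambda>E. kappa3 n E \<ge> k)) \<longlonglongrightarrow> 0"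
    if r: "\<And>n. 0 \<le> r n \<and> r n \<le> 1" and le: "\<forall>\<^sub>F n in sequentially. r n \<le> 1 / 8 * p n" for r
  proof -
    \<comment> \<open>The constant \<open>1 / 8\<close> and \<open>upper\<close> give
      \<open>r n <= ln n / (4 * n)\<close>. The expected number of isolated vertices is then at
      least the square root of \<open>n\<close>, which gives the first term; the second bounds
      \<open>r n / (1 - r n)\<close> by \<open>2 * r n\<close>.\<close>
    define b where "b n = 1 / real n powr (1 / 2) + ln (real n) / (2 * real n)" for n
    have small: "\<forall>\<^sub>F n in sequentially. ln (real n) / (4 * real n) \<le> 1 / 2"
      by real_asymp
    have le_b: "\<forall>\<^sub>F n in sequentially. gnp_prob n (r n) (\<lambda>E. kappa3 n E \<ge> k) \<le> b n"
      using le upper small eventually_ge_at_top[of 2]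
    proof eventually_elim
      case (elim n)
      have r_le: "r n \<le> ln (real n) / (4 * real n)"
        using elim(1,2) by (simp add: mult.commute)
      have r_half: "r n \<le> 1 / 2" using r_le elim by linarith
      then have r_less: "r n < 1" by linarith
      have "real n powr (1 / 2) \<le> real n * (1 - r n) ^ (n - 1)"
      proof -
        have "real n powr (1 / 2) = real n * exp (- (ln (real n) / 2))"
        proof -
          have "real n * exp (- (ln (real n) / 2)) = exp (ln (real n) + - (ln (real n) / 2))"
            using elim by (subst exp_add) simp
          then show ?thesis
            using elim by (simp add: powr_def)
        qed
        also have "\<dots> \<le> real n * exp (- 2 * r n) ^ n"
          using r_le elim by (auto simp: exp_of_nat_mult[symmetric] field_simps)
        also have "\<dots> \<le> real n * (1 - r n) ^ n"
          using exp_minus_twice_le[of "r n"] r[of n] r_half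
          by (intro mult_left_mono power_mono) auto
        also have "\<dots> \<le> real n * (1 - r n) ^ (n - 1)"
          using r[of n] by (intro mult_left_mono power_decreasing) auto
        finally show ?thesis .
      qed
      then have "1 / (real n * (1 - r n) ^ (n - 1)) \<le> 1 / real n powr (1 / 2)"
        using elim by (intro divide_left_mono mult_pos_pos) (use r_half in auto)
      moreover have "r n / (1 - r n) \<le> ln (real n) / (2 * real n)"
      proof -
        have "r n / (1 - r n) \<le> r n / (1 / 2)"
          using r[of n] r_half by (intro divide_left_mono) auto
        then show ?thesis using r_le by simp
      qed
      moreover have "gnp_prob n (r n) (\<lambda>E. kappa3 n E \<ge> k)
          \<le> gnp_prob n (r n) (\<lambda>E. \<forall>v<n. E \<inter> star_edges n v \<noteq> {})"
      \<comment> \<open>As \<open>k\<close> is at least 1, \<open>kappa3 n E >= k\<close> rules out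
        the default value 0, so the graph is connected and has no isolated vertex.\<close>
      proof (rule gnp_prob_mono)
        fix E assume E: "E \<subseteq> all_edges n" "k \<le> kappa3 n E"
        then have "graph_connected {..<n} E"
          using assms by (auto simp: kappa3_def split: if_splits)
        then show "\<forall>v<n. E \<inter> star_edges n v \<noteq> {}"
          using isolated_not_connected E elim by blast
      qed (use r in auto)
      moreover have "gnp_prob n (r n) (\<lambda>E. \<forall>v<n. E \<inter> star_edges n v \<noteq> {})
          \<le> 1 / (real n * (1 - r n) ^ (n - 1)) + r n / (1 - r n)"
        using r[of n] r_less elim(4) by (intro gnp_prob_no_isolated_le) auto
      ultimately show ?case
        unfolding b_def by linarith
    qed
    have "b \<longlonglongrightarrow> 0"
      unfolding b_def by real_asymp
    then show ?thesis
      using r by (intro tendsto_sandwich[OF _ le_b tendsto_const] always_eventually allI gnp_prob_nonneg) auto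
  qed
  show ?thesis
    unfolding sharp_threshold_def p_def[symmetric]
    using above below k by (intro exI[of _ "1 / 8"] exI[of _ "20 * real k"]) auto
qed

end
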